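(* (a) For every $(u^2,\beta^1)\in\operatorname{dom}J^2\times\mathbb R^\tau$, $$\mathcal E_{\beta^1}^{u^2}=\bigcup_{u^1\in\tilde H^1(\mathcal E_{\beta^1}^{u^2})}\mathcal E^{u^1,u^2}.$$ (b) Let $u^2\in\operatorname{dom}J^2$ and $u^1\in\operatorname{dom}s^{u^2}$. (Full equivalence) If $u^1\in C^{u^2}$ and $u^1\in T^{u^2}$, then there exists $\beta^1\in\partial(s^{u^2})^{**}(u^1)$ such that $\mathcal E^{u^1,u^2}=\mathcal E_{\beta^1}^{u^2}$. (Partial equivalence) If $u^1\in C^{u^2}$ and $u^1\notin T^{u^2}$, then $\mathcal E^{u^1,u^2}\subsetneq\mathcal E_{\beta^1}^{u^2}$ for all $\beta^1\in\partial(s^{u^2})^{**}(u^1)$. (Nonequivalence) If $u^1\notin C^{u^2}$, then $\mathcal E^{u^1,u^2}\cap\mathcal E_{\beta^1}^{u^2}=\emptyset$ for all $\beta^1\in\mathbb R^\tau$.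
   Context: Setting. For each $n\in\mathbb N$, $(\Omega_n,\mathcal F_n,P_n)$ is a probability space; $\sigma\ge2$ is an integer; $H_{n,1},\dots,H_{n,\sigma}:\Omega_n\to\mathbb R$ are bounded measurable functions; $a_n>0$ with $a_n\to\infty$. $\mathcal X$ is a Polish space, $Y_n:\Omega_n\to\mathcal X$ are random variables, and $\tilde H_1,\dots,\tilde H_\sigma:\mathcal X\to\mathbb R$ are bounded continuous functions such that $\lim_{n\to\infty}\sup_{\omega\in\Omega_n}|H_{n,i}(\omega)-\tilde H_i(Y_n(\omega))|=0$ for each $i$. With respect to $P_n$, $Y_n$ satisfies the large deviation principle on $\mathcal X$ with scaling constants $a_n$ and rate function $I:\mathcal X\to[0,\infty]$, where rate functions have compact level sets $\{I\le M\}$, $0\le M<\infty$ (in particular $\inf_{\mathcal X}I=0$). $\langle\cdot,\cdot\rangle$ denotes Euclidean inner products. $\tau$ is an integer with $1\le\tau\le\sigma$ (with $\mathbb R^0$ a single point if $\tau=\sigma$); $\tilde H^1:=(\tilde H_1,\dots,\tilde H_\tau)$, $\tilde H^2:=(\tilde H_{\tau+1},\dots,\tilde H_\sigma)$. Definitions (with $\inf\emptyset=\infty$). $J^2(u^2):=\inf\{I(x):x\in\mathcal X,\tilde H^2(x)=u^2\}$, $J(u^1,u^2):=\inf\{I(x):x\in\mathcal X,\tilde H^1(x)=u^1,\tilde H^2(x)=u^2\}$; $\operatorname{dom}J^2$, $\operatorname{dom}J$ are the sets where these are finite. Mixed equilibrium macrostates, for $\beta^1\in\mathbb R^\tau$,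 $u^2\in\operatorname{dom}J^2$: $\mathcal E_{\beta^1}^{u^2}:=\{x\in\mathcal X:\tilde H^2(x)=u^2,\ I(x)+\langle\beta^1,\tilde H^1(x)\rangle=\inf\{I(y)+\langle\beta^1,\tilde H^1(y)\rangle:\tilde H^2(y)=u^2\}\}$. Microcanonical equilibrium macrostates, for $(u^1,u^2)\in\operatorname{dom}J$: $\mathcal E^{u^1,u^2}:=\{x\in\mathcal X:I(x)=J(u^1,u^2),\ \tilde H^1(x)=u^1,\ \tilde H^2(x)=u^2\}$. For $u^2\in\operatorname{dom}J^2$ and $u^1\in\mathbb R^\tau$: $s^{u^2}(u^1):=-(J(u^1,u^2)-J^2(u^2))$, $\operatorname{dom}s^{u^2}:=\{u^1:s^{u^2}(u^1)>-\infty\}$, so $u^1\in\operatorname{dom}s^{u^2}$ iff $(u^1,u^2)\in\operatorname{dom}J$. Its Legendre–Fenchel transform is $(s^{u^2})^*(\beta^1):=\inf_{w\in\mathbb R^\tau}\{\langle\beta^1,w\rangle-s^{u^2}(w)\}$ and $(s^{u^2})^{**}(u^1):=\inf_{\beta^1\in\mathbb R^\tau}\{\langle\beta^1,u^1\rangle-(s^{u^2})^*(\beta^1)\}$. $\partial(s^{u^2})^{**}(u^1)$ is the set of $\beta^1\in\mathbb R^\tau$ with $(s^{u^2})^{**}(w)\le(s^{u^2})^{**}(u^1)+\langle\beta^1,w-u^1\rangle$ for all $w\in\mathbb R^\tau$. $C^{u^2}$ is the set of $u^1\in\mathbb R^\tau$ for which there exists $\beta^1\in\mathbb R^\tau$ such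 that $s^{u^2}(w)\le s^{u^2}(u^1)+\langle\beta^1,w-u^1\rangle$ for all $w\in\mathbb R^\tau$; $T^{u^2}$ is the set of $u^1\in\mathbb R^\tau$ for which there exists $\beta^1\in\mathbb R^\tau$ such that $s^{u^2}(w)<s^{u^2}(u^1)+\langle\beta^1,w-u^1\rangle$ for all $w\ne u^1$. *)

theory Defs
  imports "HOL-Probability.Probability"
begin

definition ereal_log :: "real \<Rightarrow> ereal" where
  "ereal_log p = (if p = 0 then -\<infinity> else ereal (ln p))"

text \<open>Compactness of the level sets already gives lower semicontinuity (in a Hausdorff space).\<close>

definition rate_function :: "('x::topological_space \<Rightarrow> ereal) \<Rightarrow> bool" where
  "rate_function I \<longleftrightarrow> (\<forall>x. 0 \<le> I x) \<and> (\<forall>M::real. 0 \<le> M \<longrightarrow> compact {x. I x \<le> ereal M})"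

definition LDP ::
  "(nat \<Rightarrow> 'w measure) \<Rightarrow> (nat \<Rightarrow> 'w \<Rightarrow> 'x::topological_space) \<Rightarrow> (nat \<Rightarrow> real) \<Rightarrow> ('x \<Rightarrow> ereal) \<Rightarrow> bool"
  where
  "LDP P Y a I \<longleftrightarrow> rate_function I \<and>
     (\<forall>F. closed F \<longrightarrow>
        limsup (\<lambda>n. ereal (1 / a n) * ereal_log (measure (P n) (Y n -` F \<inter> space (P n))))
          \<le> - (INF x\<in>F. I x)) \<and>
     (\<forall>G. open G \<longrightarrow>
        - (INF x\<in>G. I x)
          \<le> liminf (\<lambda>n. ereal (1 / a n) * ereal_log (measure (P n) (Y n -` G \<inter> space (P n)))))"

text \<open>
  The Euclidean space with coordinates indexed by a finite set \<open>K\<close> of naturals is the set of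
  functions \<open>nat \<Rightarrow> real\<close> that are \<open>undefined\<close> outside \<open>K\<close>, so that equality of vectors is equality
  of functions. For \<open>K = {}\<close> this is a single point, which covers the zero-dimensional case.
\<close>

type_synonym vec = "nat \<Rightarrow> real"

definition eucl :: "nat set \<Rightarrow> vec set" where
  "eucl K = K \<rightarrow>\<^sub>E UNIV"

definition ip :: "nat set \<Rightarrow> vec \<Rightarrow> vec \<Rightarrow> real" where
  "ip K \<beta> u = (\<Sum>i\<in>K. \<beta> i * u i)"

definition vdiff :: "nat set \<Rightarrow> vec \<Rightarrow> vec \<Rightarrow> vec" where
  "vdiff K w u = (\<lambda>i\<in>K. w i - u i)"

definition vmap :: "nat set \<Rightarrow> (nat \<Rightarrow> 'x \<Rightarrow> real) \<Rightarrow> 'x \<Rightarrow> vec" where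
  "vmap K h x = (\<lambda>i\<in>K. h i x)"

definition LF_transform :: "nat set \<Rightarrow> (vec \<Rightarrow> ereal) \<Rightarrow> vec \<Rightarrow> ereal" where
  "LF_transform K f \<beta> = (INF w\<in>eucl K. ereal (ip K \<beta> w) - f w)"

definition superdiff :: "nat set \<Rightarrow> (vec \<Rightarrow> ereal) \<Rightarrow> vec \<Rightarrow> vec set" where
  "superdiff K f u =
     {\<beta> \<in> eucl K. \<forall>w\<in>eucl K. f w \<le> f u + ereal (ip K \<beta> (vdiff K w u))}"

definition support_set :: "nat set \<Rightarrow> (vec \<Rightarrow> ereal) \<Rightarrow> vec set" where
  "support_set K f =
     {u \<in> eucl K. \<exists>\<beta>\<in>eucl K. \<forall>w\<in>eucl K. f w \<le> f u + ereal (ip K \<beta> (vdiff K w u))}"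

definition strict_support_set :: "nat set \<Rightarrow> (vec \<Rightarrow> ereal) \<Rightarrow> vec set" where
  "strict_support_set K f =
     {u \<in> eucl K. \<exists>\<beta>\<in>eucl K. \<forall>w\<in>eucl K. w \<noteq> u \<longrightarrow>
        f w < f u + ereal (ip K \<beta> (vdiff K w u))}"

definition dom_concave :: "nat set \<Rightarrow> (vec \<Rightarrow> ereal) \<Rightarrow> vec set" where
  "dom_concave K f = {u \<in> eucl K. f u > -\<infinity>}"

text \<open>
  Below, \<open>H1\<close> and \<open>H2\<close> are the vector-valued representation functions of the quantities treated
  canonically and microcanonically, respectively. Infima are taken in \<open>ereal\<close>, where the infimum
  of the empty set is \<open>\<infinity>\<close>.
\<close>

definition J2 :: "('x \<Rightarrow> ereal) \<Rightarrow> ('x \<Rightarrow> vec) \<Rightarrow> vec \<Rightarrow> ereal" where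
  "J2 I H2 u2 = (INF x\<in>{x. H2 x = u2}. I x)"

definition J :: "('x \<Rightarrow> ereal) \<Rightarrow> ('x \<Rightarrow> vec) \<Rightarrow> ('x \<Rightarrow> vec) \<Rightarrow> vec \<Rightarrow> vec \<Rightarrow> ereal" where
  "J I H1 H2 u1 u2 = (INF x\<in>{x. H1 x = u1 \<and> H2 x = u2}. I x)"

definition dom_J2 :: "nat set \<Rightarrow> ('x \<Rightarrow> ereal) \<Rightarrow> ('x \<Rightarrow> vec) \<Rightarrow> vec set" where
  "dom_J2 K2 I H2 = {u2 \<in> eucl K2. J2 I H2 u2 < \<infinity>}"

definition mixed_macro ::
  "nat set \<Rightarrow> ('x \<Rightarrow> ereal) \<Rightarrow> ('x \<Rightarrow> vec) \<Rightarrow> ('x \<Rightarrow> vec) \<Rightarrow> vec \<Rightarrow> vec \<Rightarrow> 'x set" where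
  "mixed_macro K1 I H1 H2 \<beta> u2 =
     {x. H2 x = u2 \<and>
         I x + ereal (ip K1 \<beta> (H1 x)) = (INF y\<in>{y. H2 y = u2}. I y + ereal (ip K1 \<beta> (H1 y)))}"

text \<open>Meaningful only where \<open>J I H1 H2 u1 u2\<close> is finite.\<close>

definition micro_macro ::
  "('x \<Rightarrow> ereal) \<Rightarrow> ('x \<Rightarrow> vec) \<Rightarrow> ('x \<Rightarrow> vec) \<Rightarrow> vec \<Rightarrow> vec \<Rightarrow> 'x set" where
  "micro_macro I H1 H2 u1 u2 = {x. I x = J I H1 H2 u1 u2 \<and> H1 x = u1 \<and> H2 x = u2}"

definition mixed_entropy ::
  "('x \<Rightarrow> ereal) \<Rightarrow> ('x \<Rightarrow> vec) \<Rightarrow> ('x \<Rightarrow> vec) \<Rightarrow> vec \<Rightarrow> vec \<Rightarrow> ereal" where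
  "mixed_entropy I H1 H2 u2 u1 = - (J I H1 H2 u1 u2 - J2 I H2 u2)"

end

theory Submission
  imports Defs
begin

text \<open>
  Everything rests on one equivalence, \<open>mixed_macro_iff\<close>: a point \<open>x\<close> of the fibre
  \<open>H2 = u2\<close> minimizes \<open>I + \<langle>\<beta>, H1\<rangle>\<close> there if and only if it minimizes \<open>I\<close> on its own finer
  fibre \<open>H1 = H1 x, H2 = u2\<close> and \<open>\<beta>\<close> is a supergradient of the entropy \<open>s u2\<close> at \<open>H1 x\<close>.
  The reason is that the minimization can be carried out in two stages: along each fine fibre the
  linear term is constant, and the minimum of \<open>I\<close> there is \<open>J\<close>; what remains is the
  minimization of \<open>J u1 u2 + \<langle>\<beta>, u1\<rangle>\<close> over \<open>u1\<close>, which up to constants is the statement that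
  \<open>\<beta>\<close> supports \<open>s u2\<close> from above.

  Hence the mixed macrostates for \<open>\<beta>\<close> are the disjoint union of the microcanonical ones over the
  points \<open>u1\<close> at which \<open>\<beta>\<close> supports \<open>s u2\<close>. Part (a) and nonequivalence are immediate. For full
  equivalence, a strictly supporting \<open>\<beta>\<close> supports at no other point. For partial equivalence,
  a supporting \<open>\<beta>\<close> that is not strict touches the graph at a second point \<open>w\<close>, and the fine fibre
  over \<open>w\<close> contributes an additional macrostate; that this fibre does contain a minimizer of \<open>I\<close>
  is where compactness of the level sets and continuity of the representation functions enter.
  Finally, at a point where \<open>s u2\<close> is finite and has a supergradient it agrees with its biconjugate and has the
  same supergradients, so that \<open>\<beta>\<close> may be chosen from the superdifferential of either function.
\<close>

section \<open>Supergradients and the biconjugate\<close>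

lemma ip_vdiff: "ip K \<beta> (vdiff K w u) = ip K \<beta> w - ip K \<beta> u"
  by (simp add: ip_def vdiff_def right_diff_distrib sum_subtractf)

lemma support_set_iff_superdiff: "u \<in> support_set K f \<longleftrightarrow> u \<in> eucl K \<and> superdiff K f u \<noteq> {}"
  by (auto simp: support_set_def superdiff_def)

lemma le_biconjugate:
  assumes "w \<in> eucl K"
  shows "f w \<le> LF_transform K (LF_transform K f) w"
  unfolding LF_transform_def[of K "LF_transform K f"]
proof (rule INF_greatest)
  fix \<beta>
  have "LF_transform K f \<beta> \<le> ereal (ip K \<beta> w) - f w"
    unfolding LF_transform_def by (rule INF_lower[OF assms])
  then have "f w \<le> ereal (ip K \<beta> w) - LF_transform K f \<beta>"
    by (cases "f w"; cases "LF_transform K f \<beta>") auto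
  then show "f w \<le> ereal (ip K w \<beta>) - LF_transform K f \<beta>"
    by (simp add: ip_def mult.commute)
qed

text \<open>The affine function with slope \<open>\<beta>\<close> that touches \<open>f\<close> at \<open>u\<close> is one of those over which the
  biconjugate is the infimum.\<close>

lemma biconjugate_le_affine:
  assumes \<beta>: "\<beta> \<in> superdiff K f u" and fin: "\<bar>f u\<bar> \<noteq> \<infinity>"
  shows "LF_transform K (LF_transform K f) w \<le> f u + ereal (ip K \<beta> (vdiff K w u))"
proof -
  obtain r where r: "f u = ereal r" using fin by auto
  have \<beta>K: "\<beta> \<in> eucl K" using \<beta> by (simp add: superdiff_def)
  have conj: "ereal (ip K \<beta> u - r) \<le> LF_transform K f \<beta>"
    unfolding LF_transform_def
  proof (rule INF_greatest)
    fix v assume "v \<in> eucl K"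
    then have "f v \<le> ereal (r + (ip K \<beta> v - ip K \<beta> u))"
      using \<beta> r by (simp add: superdiff_def ip_vdiff)
    then show "ereal (ip K \<beta> u - r) \<le> ereal (ip K \<beta> v) - f v"
      by (cases "f v") auto
  qed
  have "LF_transform K (LF_transform K f) w \<le> ereal (ip K w \<beta>) - LF_transform K f \<beta>"
    unfolding LF_transform_def[of K "LF_transform K f"] by (rule INF_lower[OF \<beta>K])
  also have "\<dots> \<le> ereal (ip K w \<beta>) - ereal (ip K \<beta> u - r)"
    by (rule ereal_minus_mono[OF order_refl conj])
  also have "\<dots> = f u + ereal (ip K \<beta> (vdiff K w u))"
    using r by (simp add: ip_vdiff) (simp add: ip_def mult.commute)
  finally show ?thesis .
qed

text \<open>The biconjugate lies between \<open>f\<close> and each affine function that supports \<open>f\<close> at \<open>u\<close>, so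
  \<open>f\<close> and its biconjugate coincide at \<open>u\<close> and have the same supporting slopes there.\<close>

lemma superdiff_biconjugate:
  assumes u: "u \<in> support_set K f" and fin: "\<bar>f u\<bar> \<noteq> \<infinity>"
  shows "superdiff K (LF_transform K (LF_transform K f)) u = superdiff K f u"
proof -
  let ?g = "LF_transform K (LF_transform K f)"
  obtain \<gamma> where \<gamma>: "\<gamma> \<in> superdiff K f u" and uK: "u \<in> eucl K"
    using u by (auto simp: support_set_iff_superdiff)
  have "?g u \<le> f u"
    using biconjugate_le_affine[OF \<gamma> fin, of u] by (simp add: ip_vdiff)
  then have eq: "?g u = f u"
    using le_biconjugate[OF uK, of f] by simp
  show ?thesis
  proof
    show "superdiff K ?g u \<subseteq> superdiff K f u"
      unfolding superdiff_def eq using le_biconjugate[of _ K f] order_trans by blast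
    show "superdiff K f u \<subseteq> superdiff K ?g u"
    proof
      fix \<beta> assume \<beta>: "\<beta> \<in> superdiff K f u"
      then show "\<beta> \<in> superdiff K ?g u"
        using biconjugate_le_affine[OF \<beta> fin] by (simp add: superdiff_def eq)
    qed
  qed
qed

text \<open>Supporting inequalities with the same slope at \<open>u\<close> and at \<open>w\<close>, taken at each other's base
  point, are reverse to each other; strictness of one makes them contradictory.\<close>

lemma strict_supergradient_unique:
  assumes strict: "\<And>w. w \<in> eucl K \<Longrightarrow> w \<noteq> u \<Longrightarrow> f w < f u + ereal (ip K \<beta> (vdiff K w u))"
    and fin: "\<bar>f u\<bar> \<noteq> \<infinity>" and u: "u \<in> eucl K"
    and w: "w \<in> eucl K" "\<beta> \<in> superdiff K f w"
  shows "w = u"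
proof (rule ccontr)
  assume "w \<noteq> u"
  then have 1: "f w < f u + ereal (ip K \<beta> (vdiff K w u))"
    using strict w(1) by blast
  have 2: "f u \<le> f w + ereal (ip K \<beta> (vdiff K u w))"
    using w u by (auto simp: superdiff_def)
  show False
    using 1 2 fin by (cases "f w"; cases "f u") (auto simp: ip_vdiff)
qed

text \<open>A supporting hyperplane supports at every point where it meets the graph. This produces the
  additional macrostates in partial equivalence.\<close>

lemma superdiff_transfer:
  assumes \<beta>: "\<beta> \<in> superdiff K f u" and fin: "\<bar>f u\<bar> \<noteq> \<infinity>" and w: "w \<in> eucl K"
    and touch: "f u + ereal (ip K \<beta> (vdiff K w u)) \<le> f w"
  shows "\<beta> \<in> superdiff K f w" and "\<bar>f w\<bar> \<noteq> \<infinity>"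
proof -
  obtain r where r: "f u = ereal r" using fin by auto
  have *: "f v \<le> ereal (r + (ip K \<beta> v - ip K \<beta> u))" if "v \<in> eucl K" for v
    using \<beta> r that by (simp add: superdiff_def ip_vdiff)
  have fw: "f w = ereal (r + (ip K \<beta> w - ip K \<beta> u))"
    using *[OF w] touch by (simp add: r ip_vdiff)
  then show "\<bar>f w\<bar> \<noteq> \<infinity>" by simp
  show "\<beta> \<in> superdiff K f w"
    using \<beta> * by (auto simp: superdiff_def fw ip_vdiff algebra_simps)
qed

section \<open>Two-stage minimization\<close>

lemma mixed_macro_iff_le:
  "x \<in> mixed_macro K I H1 H2 \<beta> u2 \<longleftrightarrow> H2 x = u2 \<and>
    (\<forall>y. H2 y = u2 \<longrightarrow> I x + ereal (ip K \<beta> (H1 x)) \<le> I y + ereal (ip K \<beta> (H1 y)))"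
proof -
  have "I x + ereal (ip K \<beta> (H1 x)) = (INF y\<in>{y. H2 y = u2}. I y + ereal (ip K \<beta> (H1 y))) \<longleftrightarrow>
      I x + ereal (ip K \<beta> (H1 x)) \<le> (INF y\<in>{y. H2 y = u2}. I y + ereal (ip K \<beta> (H1 y)))"
    if "H2 x = u2"
    using that by (auto intro!: antisym INF_lower)
  then show ?thesis
    unfolding mixed_macro_def by (auto simp: le_INF_iff)
qed

lemma micro_macro_iff_le:
  "x \<in> micro_macro I H1 H2 u1 u2 \<longleftrightarrow> H1 x = u1 \<and> H2 x = u2 \<and>
    (\<forall>y. H1 y = u1 \<longrightarrow> H2 y = u2 \<longrightarrow> I x \<le> I y)"
proof -
  have "I x = J I H1 H2 u1 u2 \<longleftrightarrow> I x \<le> J I H1 H2 u1 u2" if "H1 x = u1" "H2 x = u2"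
    using that unfolding J_def by (auto intro!: antisym INF_lower)
  then show ?thesis
    unfolding micro_macro_def J_def by (auto simp: le_INF_iff)
qed

lemma J_nonneg:
  assumes "\<And>x. 0 \<le> I x"
  shows "0 \<le> J I H1 H2 u1 u2"
  using assms unfolding J_def by (auto intro: INF_greatest)

lemma J2_finite:
  assumes "\<And>x. 0 \<le> I x" "u2 \<in> dom_J2 K2 I H2"
  shows "\<bar>J2 I H2 u2\<bar> \<noteq> \<infinity>"
proof -
  have "0 \<le> J2 I H2 u2" using assms(1) unfolding J2_def by (auto intro: INF_greatest)
  then show ?thesis using assms(2) by (auto simp: dom_J2_def)
qed

lemma mixed_entropy_finite_iff:
  assumes "\<And>x. 0 \<le> I x" "\<bar>J2 I H2 u2\<bar> \<noteq> \<infinity>"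
  shows "\<bar>mixed_entropy I H1 H2 u2 u1\<bar> \<noteq> \<infinity> \<longleftrightarrow> J I H1 H2 u1 u2 < \<infinity>"
    and "mixed_entropy I H1 H2 u2 u1 > -\<infinity> \<longleftrightarrow> J I H1 H2 u1 u2 < \<infinity>"
proof -
  have "0 \<le> J I H1 H2 u1 u2" by (rule J_nonneg[OF assms(1)])
  then show "\<bar>mixed_entropy I H1 H2 u2 u1\<bar> \<noteq> \<infinity> \<longleftrightarrow> J I H1 H2 u1 u2 < \<infinity>"
    and "mixed_entropy I H1 H2 u2 u1 > -\<infinity> \<longleftrightarrow> J I H1 H2 u1 u2 < \<infinity>"
    using assms(2)
    by (cases "J I H1 H2 u1 u2"; cases "J2 I H2 u2"; simp add: mixed_entropy_def)+
qed

text \<open>The outer stage of the minimization: since \<open>J2\<close> is a finite constant, a supergradient of the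
  entropy is the same thing as a slope that makes \<open>u\<close> a minimizer of the tilted \<open>J\<close>.\<close>

lemma superdiff_mixed_entropy_iff:
  assumes "\<And>x. 0 \<le> I x" and J2: "\<bar>J2 I H2 u2\<bar> \<noteq> \<infinity>" and \<beta>: "\<beta> \<in> eucl K"
  shows "\<beta> \<in> superdiff K (mixed_entropy I H1 H2 u2) u \<longleftrightarrow>
    (\<forall>w\<in>eucl K. J I H1 H2 u u2 + ereal (ip K \<beta> u) \<le> J I H1 H2 w u2 + ereal (ip K \<beta> w))"
proof -
  obtain c where c: "J2 I H2 u2 = ereal c" using J2 by auto
  have "mixed_entropy I H1 H2 u2 w \<le> mixed_entropy I H1 H2 u2 u + ereal (ip K \<beta> (vdiff K w u)) \<longleftrightarrow>
      J I H1 H2 u u2 + ereal (ip K \<beta> u) \<le> J I H1 H2 w u2 + ereal (ip K \<beta> w)" for w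
    using J_nonneg[of I H1 H2 u u2, OF assms(1)] J_nonneg[of I H1 H2 w u2, OF assms(1)]
    by (cases "J I H1 H2 u u2"; cases "J I H1 H2 w u2")
      (auto simp: mixed_entropy_def c ip_vdiff)
  then show ?thesis using \<beta> by (simp add: superdiff_def)
qed

text \<open>Both sides exclude \<open>I x = \<infinity>\<close>: finiteness of \<open>J2\<close> puts a point of finite \<open>I\<close> in the fibre
  \<open>H2 = u2\<close>, so that a minimizer has finite \<open>I\<close>, and the entropy, being finite somewhere, has no
  supergradient where it is \<open>-\<infinity>\<close>.\<close>

lemma mixed_macro_iff:
  assumes nonneg: "\<And>x. 0 \<le> I x" and J2: "\<bar>J2 I H2 u2\<bar> \<noteq> \<infinity>" and \<beta>: "\<beta> \<in> eucl K"
    and H1: "\<And>x. H1 x \<in> eucl K"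
  shows "x \<in> mixed_macro K I H1 H2 \<beta> u2 \<longleftrightarrow>
    x \<in> micro_macro I H1 H2 (H1 x) u2 \<and> \<beta> \<in> superdiff K (mixed_entropy I H1 H2 u2) (H1 x)"
    (is "?mixed \<longleftrightarrow> ?micro \<and> ?super")
proof
  assume mixed: ?mixed
  then have x: "H2 x = u2"
    and min: "\<And>y. H2 y = u2 \<Longrightarrow> I x + ereal (ip K \<beta> (H1 x)) \<le> I y + ereal (ip K \<beta> (H1 y))"
    by (auto simp: mixed_macro_iff_le)
  have "I x \<le> I y" if "H1 y = H1 x" "H2 y = u2" for y
    using min[OF that(2)] that(1) by (cases "I x"; cases "I y") auto
  then have micro: ?micro using x by (simp add: micro_macro_iff_le)
  have "I x + ereal (ip K \<beta> (H1 x)) \<le> J I H1 H2 w u2 + ereal (ip K \<beta> w)" for w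
  proof -
    have "I x + ereal (ip K \<beta> (H1 x) - ip K \<beta> w) \<le> J I H1 H2 w u2"
      unfolding J_def
    proof (rule INF_greatest)
      fix y assume "y \<in> {x. H1 x = w \<and> H2 x = u2}"
      then show "I x + ereal (ip K \<beta> (H1 x) - ip K \<beta> w) \<le> I y"
        using min[of y] by (cases "I x"; cases "I y") auto
    qed
    then show ?thesis
      by (cases "I x"; cases "J I H1 H2 w u2") auto
  qed
  moreover have "I x = J I H1 H2 (H1 x) u2" using micro by (simp add: micro_macro_def)
  ultimately have ?super
    using superdiff_mixed_entropy_iff[of I H2 u2 \<beta> K H1 "H1 x", OF nonneg J2 \<beta>] by simp
  with micro show "?micro \<and> ?super" ..
next
  assume "?micro \<and> ?super"
  then have micro: ?micro and super: ?super by blast+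
  have x: "H2 x = u2" and Ix: "I x = J I H1 H2 (H1 x) u2"
    using micro unfolding micro_macro_def by blast+
  have sup: "J I H1 H2 (H1 x) u2 + ereal (ip K \<beta> (H1 x)) \<le> J I H1 H2 w u2 + ereal (ip K \<beta> w)"
    if "w \<in> eucl K" for w
    using super that superdiff_mixed_entropy_iff[of I H2 u2 \<beta> K H1 "H1 x", OF nonneg J2 \<beta>]
    by blast
  have "I x + ereal (ip K \<beta> (H1 x)) \<le> I y + ereal (ip K \<beta> (H1 y))" if "H2 y = u2" for y
  proof -
    have "J I H1 H2 (H1 y) u2 \<le> I y"
      unfolding J_def using that by (auto intro: INF_lower)
    then show ?thesis
      using sup[OF H1[of y]] Ix by (metis add_right_mono order_trans)
  qed
  with x show ?mixed by (simp add: mixed_macro_iff_le)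
qed

section \<open>Existence of microcanonical macrostates\<close>

lemma closed_vmap_fibre:
  fixes h :: "nat \<Rightarrow> 'x::topological_space \<Rightarrow> real"
  assumes "\<And>i. i \<in> K \<Longrightarrow> continuous_on UNIV (h i)"
  shows "closed {x. vmap K h x = u}"
proof (cases "u \<in> eucl K")
  case True
  then have u: "u \<in> extensional K" by (simp add: eucl_def PiE_def)
  have "vmap K h x = u \<longleftrightarrow> (\<forall>i\<in>K. h i x = u i)" for x
  proof
    assume "vmap K h x = u"
    then show "\<forall>i\<in>K. h i x = u i" by (auto simp: vmap_def)
  next
    assume "\<forall>i\<in>K. h i x = u i"
    then show "vmap K h x = u"
      unfolding vmap_def by (intro extensionalityI[of _ K] u) auto
  qed
  then have "{x. vmap K h x = u} = (\<Inter>i\<in>K. {x. h i x = u i})" by auto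
  moreover have "closed {x. h i x = u i}" if "i \<in> K" for i
    using assms[OF that] by (intro closed_Collect_eq) auto
  ultimately show ?thesis by auto
next
  case False
  then have "{x. vmap K h x = u} = {}"
    by (auto simp: vmap_def eucl_def)
  then show ?thesis by simp
qed

text \<open>The sublevel sets of \<open>I\<close> in \<open>A\<close> above the infimum are nested, nonempty and compact; a point
  common to all of them is a minimizer.\<close>

lemma rate_function_attains_INF:
  fixes I :: "'x::t2_space \<Rightarrow> ereal"
  assumes rate: "rate_function I" and A: "closed A" and fin: "(INF x\<in>A. I x) < \<infinity>"
  shows "\<exists>x\<in>A. I x = (INF x\<in>A. I x)"
proof -
  have nonneg: "\<And>x. 0 \<le> I x" and cpt: "\<And>M. 0 \<le> M \<Longrightarrow> compact {x. I x \<le> ereal M}"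
    using rate by (auto simp: rate_function_def)
  have "0 \<le> (INF x\<in>A. I x)" using nonneg by (auto intro: INF_greatest)
  then obtain m where m: "(INF x\<in>A. I x) = ereal m" "0 \<le> m"
    using fin by (cases "INF x\<in>A. I x") auto
  define C where "C r = A \<inter> {x. I x \<le> ereal r}" for r
  have C_compact: "compact (C r)" if "m < r" for r
    unfolding C_def using cpt[of r] that m(2) A by (simp add: closed_Int_compact)
  have C_ne: "C r \<noteq> {}" if "m < r" for r
  proof -
    have "(INF x\<in>A. I x) < ereal r" using that m by simp
    then obtain x where "x \<in> A" "I x < ereal r" by (auto simp: INF_less_iff)
    then show ?thesis by (auto simp: C_def intro: less_imp_le)
  qed
  have "C (m + 1) \<inter> (\<Inter>r\<in>{m<..}. C r) \<noteq> {}"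
  proof (rule compact_imp_fip_image)
    show "compact (C (m + 1))" by (rule C_compact) simp
    show "closed (C r)" if "r \<in> {m<..}" for r
      using that C_compact by (auto intro: compact_imp_closed)
    fix R assume R: "finite R" "R \<subseteq> {m<..}"
    let ?r = "Min (insert (m + 1) R)"
    have "m < ?r" using R by auto
    have "C ?r \<subseteq> C r" if "r \<in> insert (m + 1) R" for r
    proof -
      have "?r \<le> r" using R that by (intro Min_le) auto
      then show ?thesis by (force simp: C_def elim: order_trans)
    qed
    then show "C (m + 1) \<inter> (\<Inter>r\<in>R. C r) \<noteq> {}"
      using C_ne[OF \<open>m < ?r\<close>] by blast
  qed
  then obtain x where x: "x \<in> A" "\<And>r. m < r \<Longrightarrow> I x \<le> ereal r"
    by (auto simp: C_def)
  have "I x \<le> ereal m"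
  proof (rule ereal_le_epsilon2)
    fix e :: real assume "0 < e"
    then show "I x \<le> ereal m + ereal e" using x(2)[of "m + e"] by simp
  qed
  moreover have "ereal m \<le> I x" using x(1) m(1) by (metis INF_lower)
  ultimately show ?thesis using x(1) m(1) by force
qed

lemma micro_macro_nonempty:
  fixes I :: "'x::t2_space \<Rightarrow> ereal"
  assumes "rate_function I" "closed {x. H1 x = u1}" "closed {x. H2 x = u2}"
    and "J I H1 H2 u1 u2 < \<infinity>"
  shows "micro_macro I H1 H2 u1 u2 \<noteq> {}"
proof -
  have "closed {x. H1 x = u1 \<and> H2 x = u2}"
    using closed_Int[OF assms(2,3)] by (simp add: Collect_conj_eq)
  from rate_function_attains_INF[OF assms(1) this] assms(4) show ?thesis
    by (auto simp: J_def micro_macro_def)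
qed

section \<open>Equivalence and nonequivalence of ensembles\<close>

theorem mainTheorem10:
  fixes P :: "nat \<Rightarrow> 'w measure"
    and \<sigma> \<tau> :: nat
    and H :: "nat \<Rightarrow> nat \<Rightarrow> 'w \<Rightarrow> real"
    and a :: "nat \<Rightarrow> real"
    and Y :: "nat \<Rightarrow> 'w \<Rightarrow> 'x::polish_space"
    and Ht :: "nat \<Rightarrow> 'x \<Rightarrow> real"
    and I :: "'x \<Rightarrow> ereal"
    and K1 K2 :: "nat set"
    and H1 H2 :: "'x \<Rightarrow> vec"
    and s :: "vec \<Rightarrow> vec \<Rightarrow> ereal"
  assumes prob: "\<And>n. prob_space (P n)"
    and sigma: "2 \<le> \<sigma>"
    and H_meas: "\<And>n i. i \<in> {1..\<sigma>} \<Longrightarrow> H n i \<in> borel_measurable (P n)"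
    and H_bdd: "\<And>n i. i \<in> {1..\<sigma>} \<Longrightarrow> bounded (H n i ` space (P n))"
    and a_pos: "\<And>n. 0 < a n"
    and a_lim: "filterlim a at_top sequentially"
    and Y_meas: "\<And>n. Y n \<in> measurable (P n) borel"
    and Ht_cont: "\<And>i. i \<in> {1..\<sigma>} \<Longrightarrow> continuous_on UNIV (Ht i)"
    and Ht_bdd: "\<And>i. i \<in> {1..\<sigma>} \<Longrightarrow> bounded (range (Ht i))"
    and approx: "\<And>i. i \<in> {1..\<sigma>} \<Longrightarrow>
          (\<lambda>n. SUP \<omega>\<in>space (P n). \<bar>H n i \<omega> - Ht i (Y n \<omega>)\<bar>) \<longlonglongrightarrow> 0"
    and ldp: "LDP P Y a I"
    and tau: "1 \<le> \<tau>" "\<tau> \<le> \<sigma>"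
    and K1_eq: "K1 = {1..\<tau>}" and K2_eq: "K2 = {\<tau>+1..\<sigma>}"
    and H1_eq: "H1 = vmap K1 Ht" and H2_eq: "H2 = vmap K2 Ht"
    and s_eq: "s = mixed_entropy I H1 H2"
  shows
    "(\<forall>u2\<in>dom_J2 K2 I H2. \<forall>\<beta>\<in>eucl K1.
        mixed_macro K1 I H1 H2 \<beta> u2
          = (\<Union>u1\<in>H1 ` mixed_macro K1 I H1 H2 \<beta> u2. micro_macro I H1 H2 u1 u2)) \<and>
     (\<forall>u2\<in>dom_J2 K2 I H2. \<forall>u1\<in>dom_concave K1 (s u2).
        (u1 \<in> support_set K1 (s u2) \<and> u1 \<in> strict_support_set K1 (s u2) \<longrightarrow>
          (\<exists>\<beta>\<in>superdiff K1 (LF_transform K1 (LF_transform K1 (s u2))) u1.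
             micro_macro I H1 H2 u1 u2 = mixed_macro K1 I H1 H2 \<beta> u2)) \<and>
        (u1 \<in> support_set K1 (s u2) \<and> u1 \<notin> strict_support_set K1 (s u2) \<longrightarrow>
          (\<forall>\<beta>\<in>superdiff K1 (LF_transform K1 (LF_transform K1 (s u2))) u1.
             micro_macro I H1 H2 u1 u2 \<subset> mixed_macro K1 I H1 H2 \<beta> u2)) \<and>
        (u1 \<notin> support_set K1 (s u2) \<longrightarrow>
          (\<forall>\<beta>\<in>eucl K1. micro_macro I H1 H2 u1 u2 \<inter> mixed_macro K1 I H1 H2 \<beta> u2 = {})))"
proof -
  have rate: "rate_function I" using ldp by (simp add: LDP_def)
  then have nonneg: "\<And>x. 0 \<le> I x" by (simp add: rate_function_def)
  have H1: "H1 x \<in> eucl K1" for x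
    by (simp add: H1_eq vmap_def eucl_def)
  have closed1: "closed {x. H1 x = u}" for u
    unfolding H1_eq using Ht_cont tau K1_eq by (intro closed_vmap_fibre) auto
  have closed2: "closed {x. H2 x = u}" for u
    unfolding H2_eq using Ht_cont tau K2_eq by (intro closed_vmap_fibre) auto
  have key: "x \<in> mixed_macro K1 I H1 H2 \<beta> u2 \<longleftrightarrow>
      x \<in> micro_macro I H1 H2 (H1 x) u2 \<and> \<beta> \<in> superdiff K1 (s u2) (H1 x)"
    if "u2 \<in> dom_J2 K2 I H2" "\<beta> \<in> eucl K1" for u2 \<beta> x
    unfolding s_eq by (rule mixed_macro_iff[OF nonneg J2_finite[OF nonneg that(1)] that(2) H1])
  have micro_H1: "H1 x = u1" if "x \<in> micro_macro I H1 H2 u1 u2" for x u1 u2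
    using that by (simp add: micro_macro_def)
  have super_eucl: "\<beta> \<in> eucl K1" if "\<beta> \<in> superdiff K1 f u" for \<beta> f u
    using that by (simp add: superdiff_def)
  have micro_subset: "micro_macro I H1 H2 u1 u2 \<subseteq> mixed_macro K1 I H1 H2 \<beta> u2"
    if "u2 \<in> dom_J2 K2 I H2" "\<beta> \<in> superdiff K1 (s u2) u1" for u1 u2 \<beta>
    using key[OF that(1) super_eucl[OF that(2)]] that(2) micro_H1 by blast

  have part_a: "mixed_macro K1 I H1 H2 \<beta> u2
      = (\<Union>u1\<in>H1 ` mixed_macro K1 I H1 H2 \<beta> u2. micro_macro I H1 H2 u1 u2)"
    if "u2 \<in> dom_J2 K2 I H2" "\<beta> \<in> eucl K1" for u2 \<beta>
    using key[OF that] micro_subset[OF that(1)] by blast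

  have full: "\<exists>\<beta>\<in>superdiff K1 (LF_transform K1 (LF_transform K1 (s u2))) u1.
      micro_macro I H1 H2 u1 u2 = mixed_macro K1 I H1 H2 \<beta> u2"
    if u2: "u2 \<in> dom_J2 K2 I H2" and u1: "u1 \<in> eucl K1" "\<bar>s u2 u1\<bar> \<noteq> \<infinity>"
      and supp: "u1 \<in> support_set K1 (s u2)" "u1 \<in> strict_support_set K1 (s u2)" for u1 u2
  proof -
    obtain \<beta> where \<beta>: "\<beta> \<in> eucl K1" and strict: "\<And>w. w \<in> eucl K1 \<Longrightarrow> w \<noteq> u1 \<Longrightarrow>
        s u2 w < s u2 u1 + ereal (ip K1 \<beta> (vdiff K1 w u1))"
      using supp(2) by (auto simp: strict_support_set_def)
    have "s u2 w \<le> s u2 u1 + ereal (ip K1 \<beta> (vdiff K1 w u1))" if "w \<in> eucl K1" for w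
      using strict[OF that] by (cases "w = u1") (auto simp: ip_vdiff)
    then have sup: "\<beta> \<in> superdiff K1 (s u2) u1" using \<beta> by (simp add: superdiff_def)
    have "mixed_macro K1 I H1 H2 \<beta> u2 \<subseteq> micro_macro I H1 H2 u1 u2"
      using key[OF u2 \<beta>] strict_supergradient_unique[OF strict u1(2,1) H1] by blast
    then show ?thesis
      using micro_subset[OF u2 sup] sup superdiff_biconjugate[OF supp(1) u1(2)] by blast
  qed

  have partial: "micro_macro I H1 H2 u1 u2 \<subset> mixed_macro K1 I H1 H2 \<beta> u2"
    if u2: "u2 \<in> dom_J2 K2 I H2" and u1: "u1 \<in> eucl K1" "\<bar>s u2 u1\<bar> \<noteq> \<infinity>"
      and supp: "u1 \<in> support_set K1 (s u2)" "u1 \<notin> strict_support_set K1 (s u2)"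
      and \<beta>': "\<beta> \<in> superdiff K1 (LF_transform K1 (LF_transform K1 (s u2))) u1" for u1 u2 \<beta>
  proof -
    have \<beta>: "\<beta> \<in> superdiff K1 (s u2) u1"
      using \<beta>' superdiff_biconjugate[OF supp(1) u1(2)] by simp
    obtain w where w: "w \<in> eucl K1" "w \<noteq> u1"
      and touch: "s u2 u1 + ereal (ip K1 \<beta> (vdiff K1 w u1)) \<le> s u2 w"
      using supp(2) u1(1) super_eucl[OF \<beta>] by (auto simp: strict_support_set_def not_less)
    note w_sup = superdiff_transfer[OF \<beta> u1(2) w(1) touch]
    have "J I H1 H2 w u2 < \<infinity>"
      using w_sup(2) mixed_entropy_finite_iff(1)[OF nonneg J2_finite[OF nonneg u2]]
      by (simp add: s_eq)
    then obtain x where x: "x \<in> micro_macro I H1 H2 w u2"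
      using micro_macro_nonempty[of I H1 w H2 u2] rate closed1 closed2 by blast
    then have "x \<in> mixed_macro K1 I H1 H2 \<beta> u2" using micro_subset[OF u2 w_sup(1)] by blast
    moreover have "x \<notin> micro_macro I H1 H2 u1 u2" using micro_H1 x w(2) by blast
    ultimately show ?thesis using micro_subset[OF u2 \<beta>] by blast
  qed

  have none: "micro_macro I H1 H2 u1 u2 \<inter> mixed_macro K1 I H1 H2 \<beta> u2 = {}"
    if "u2 \<in> dom_J2 K2 I H2" "u1 \<in> eucl K1" "u1 \<notin> support_set K1 (s u2)" "\<beta> \<in> eucl K1"
    for u1 u2 \<beta>
    using key[OF that(1,4)] micro_H1 that(2,3) by (auto simp: support_set_iff_superdiff)

  have dom: "u1 \<in> eucl K1 \<and> \<bar>s u2 u1\<bar> \<noteq> \<infinity>"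
    if "u2 \<in> dom_J2 K2 I H2" "u1 \<in> dom_concave K1 (s u2)" for u1 u2
    using that(2) mixed_entropy_finite_iff[of I H2 u2 H1 u1, OF nonneg J2_finite[OF nonneg that(1)]]
    by (simp add: dom_concave_def s_eq)
  show ?thesis
    using part_a full partial none dom by (intro conjI ballI impI) simp_all
qed

end
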